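(* In the risk model with interest rate described in the context (including its standing assumptions on the process $Y$), suppose there exist real numbers $l,t_0>0$ and $\widetilde{L}>0$ such that $$\mathbf{E}e^{\widetilde{L}(Y(t+l)-Y(t))}\le 1\quad\text{for all }t\ge t_0 .$$ Then for each $h\in[0,\widetilde{L}]$ $$\sup_{t\ge 0}\mathbf{E}e^{hY(t)}=\sup_{0\le t<t_0+l}\mathbf{E}e^{hY(t)},$$ and for any $u>0$ and $T\ge 0$, $$\psi(u,T)\le\mathbf{P}\Big(\sup_{0\le t\le T}Y(t)>u\Big)\le e^{-hu}\sup_{0\le t\le T}\mathbf{E}e^{hY(t)},\qquad \psi(u)\le\mathbf{P}\Big(\sup_{t\ge 0}Y(t)>u\Big)\le e^{-hu}\sup_{0\le t<t_0+l}\mathbf{E}e^{hY(t)}.$$ In addition, for any $u>0$, $$\psi(u)\le\inf_{h\in[0,\widetilde{L}]}\Big\{e^{-hu}\sup_{0\le t<t_0+l}\mathbf{E}e^{hY(t)}\Big\}\le C_1e^{-\widetilde{L}u},\qquad C_1:=\sup_{0\le t<t_0+l}\mathbf{E}e^{\widetilde{L}Y(t)}.$$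
   Context: Model B: $N(t)$, $t\ge 0$, is a non-homogeneous Poisson process with non-decreasing accumulated intensity function $\Lambda(t)=\mathbf{E}N(t)<\infty$, $N(0)=\Lambda(0)=0$, with claim times $T_j=\min\{t\ge 0:N(t)\ge j\}$. $Z(t)\ge 0$ denotes the claim size in case a claim arrives at time $t$; $N(\cdot)$ and $Z(\cdot)$ are independent, and the $Z(T_j)$, $j\ge1$, are independent but not necessarily identically distributed. $p(t)\ge 0$ is the non-decreasing aggregate premium income over $[0,t]$, and $q(t)$ is the total claim amount over $[0,t]$ (the principal case being $q(t)=\sum_{j=1}^{N(t)}Z(T_j)$). The risk reserve process $R$, with $R(0)=u>0$, satisfies for all $t_2>t_1\ge 0$ $$R(t_2)=(1+\alpha(t_1,t_2))R(t_1)+(1+\beta(t_1,t_2))[p(t_2)-p(t_1)]-[q(t_2)-q(t_1)],$$ where $\beta(t_1,t_2)\ge 0$ and $1+\alpha(t_1,t_2)\ge e^{r(t_2)-r(t_1)}$ for a non-random non-decreasing function $r$ with $r(0)=0$. Put $S(t)=q(t)-p(t)$, assumed of bounded variation on finite intervals, and $Y(t)=\int_0^te^{-r(x)}\,dS(x)$, so $Y(0)=0$. The ruin probabilities are $\psi(u)=\mathbf{P}(\inf_{t\ge 0}R(t)<0)$ and $\psi(u,T)=\mathbf{P}(\inf_{0\le t\le T}R(t)<0)$. Standing assumptions: (i) $e^{-r(t)}R(t)\ge u-Y(t)$ for all $t>0$; (ii) $Y$ is a separable process (in Doob's sense) with independent increments; (iii) $\Lambda$ has a density $\Lambda'$ and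 $p$ has a density $p'$, and for all $h\ge0$, $t>0$, $$\mathbf{E}e^{hY(t)}=\exp\Big\{-\int_0^the^{-r(x)}p'(x)\,dx+\int_0^t\big(\mathbf{E}e^{he^{-r(x)}Z(x)}-1\big)\Lambda'(x)\,dx\Big\}.$$ Exponential moments may equal $+\infty$. *)

theory Defs
  imports "HOL-Probability.Probability"
begin

text \<open>Processes have time domain \<open>[0, \<infinity>)\<close>: they are functions \<open>real \<Rightarrow> 'a \<Rightarrow> _\<close> of
  which only the values at times \<open>t \<ge> 0\<close> matter.\<close>

subsection \<open>Stieltjes integrals along paths\<close>

definition finite_variation_on :: "real \<Rightarrow> real \<Rightarrow> (real \<Rightarrow> real) \<Rightarrow> bool" where
  "finite_variation_on a b g \<longleftrightarrow>
     (\<exists>B. \<forall>d. d division_of {a..b} \<longrightarrow> (\<Sum>K\<in>d. \<bar>g (Sup K) - g (Inf K)\<bar>) \<le> B)"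

text \<open>The gauge (Kurzweil--Stieltjes) integral. It exists whenever \<open>f\<close> is monotone (more
  generally regulated) and \<open>g\<close> has bounded variation, even when \<open>f\<close> and \<open>g\<close> have common jumps.
  It equals the Riemann--Stieltjes integral when that exists and, for right-continuous \<open>g\<close>,
  the Lebesgue--Stieltjes integral over \<open>(a, b]\<close>.\<close>

definition has_stieltjes_integral ::
    "(real \<Rightarrow> real) \<Rightarrow> (real \<Rightarrow> real) \<Rightarrow> real \<Rightarrow> real \<Rightarrow> real \<Rightarrow> bool" where
  "has_stieltjes_integral f g a b y \<longleftrightarrow>
     (\<forall>e>0. \<exists>\<gamma>. gauge \<gamma> \<and>
        (\<forall>\<D>. \<D> tagged_division_of {a..b} \<and> \<gamma> fine \<D> \<longrightarrow>
            \<bar>(\<Sum>(x, K)\<in>\<D>. f x * (g (Sup K) - g (Inf K))) - y\<bar> < e))"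

definition stieltjes_integral ::
    "(real \<Rightarrow> real) \<Rightarrow> (real \<Rightarrow> real) \<Rightarrow> real \<Rightarrow> real \<Rightarrow> real" where
  "stieltjes_integral f g a b = (THE y. has_stieltjes_integral f g a b y)"

subsection \<open>Exponential moments\<close>

definition exp_moment :: "'a measure \<Rightarrow> ('a \<Rightarrow> real) \<Rightarrow> real \<Rightarrow> ennreal" where
  "exp_moment M X h = (\<integral>\<^sup>+\<omega>. ennreal (exp (h * X \<omega>)) \<partial>M)"

definition ennreal_exp :: "ennreal \<Rightarrow> ennreal" where
  "ennreal_exp x = (if x = \<infinity> then \<infinity> else ennreal (exp (enn2real x)))"

definition has_density_from_0 :: "(real \<Rightarrow> real) \<Rightarrow> (real \<Rightarrow> real) \<Rightarrow> bool" where
  "has_density_from_0 F f \<longleftrightarrow> (\<forall>x\<ge>0. 0 \<le> f x) \<and>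
     (\<forall>t\<ge>0. set_integrable lebesgue {0..t} f \<and> F t = (LINT x:{0..t}|lebesgue. f x))"

subsection \<open>Processes\<close>

definition independent_increments :: "'a measure \<Rightarrow> (real \<Rightarrow> 'a \<Rightarrow> real) \<Rightarrow> bool" where
  "independent_increments M X \<longleftrightarrow>
     (\<forall>n. \<forall>s :: nat \<Rightarrow> real. 0 \<le> s 0 \<and> (\<forall>i<n. s i \<le> s (Suc i)) \<longrightarrow>
        prob_space.indep_vars M (\<lambda>_. borel) (\<lambda>i \<omega>. X (s (Suc i)) \<omega> - X (s i) \<omega>) {..<n})"

text \<open>Separability as in Doob's book, i.e. relative to the class of (possibly infinite) closed
  intervals \<open>A\<close>. The exceptional set does not depend on \<open>A\<close> and on the open interval \<open>I\<close>. Only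
  one inclusion is stated, as the reverse one is trivial.\<close>

definition separable_process :: "'a measure \<Rightarrow> (real \<Rightarrow> 'a \<Rightarrow> real) \<Rightarrow> bool" where
  "separable_process M X \<longleftrightarrow>
     (\<exists>D E. countable D \<and> D \<subseteq> {0..} \<and> E \<in> null_sets M \<and>
        (\<forall>A I. closed A \<and> is_interval A \<and> open I \<and> is_interval I \<longrightarrow>
           {\<omega>\<in>space M. \<forall>t\<in>I \<inter> D. X t \<omega> \<in> A} \<subseteq> {\<omega>\<in>space M. \<forall>t\<in>I \<inter> {0..}. X t \<omega> \<in> A} \<union> E))"

text \<open>The mass function is written out because \<^const>\<open>poisson_pmf\<close> requires a positive
  parameter, whereas \<open>\<Lambda>\<close> may be constant on an interval. It gives \<open>N t\<close> the mean \<open>\<Lambda> t\<close>.\<close>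

definition nonhomogeneous_poisson ::
    "'a measure \<Rightarrow> (real \<Rightarrow> 'a \<Rightarrow> nat) \<Rightarrow> (real \<Rightarrow> real) \<Rightarrow> bool" where
  "nonhomogeneous_poisson M N \<Lambda> \<longleftrightarrow>
     (\<forall>t\<ge>0. N t \<in> measurable M (count_space UNIV)) \<and>
     (\<forall>\<omega>\<in>space M. N 0 \<omega> = 0 \<and> mono_on {0..} (\<lambda>t. N t \<omega>) \<and>
        (\<forall>t\<ge>0. continuous (at_right t) (\<lambda>s. real (N s \<omega>)))) \<and>
     independent_increments M (\<lambda>t \<omega>. real (N t \<omega>)) \<and>
     (\<forall>s t k. 0 \<le> s \<and> s \<le> t \<longrightarrow>
        measure M {\<omega>\<in>space M. N t \<omega> - N s \<omega> = k} =
          (\<Lambda> t - \<Lambda> s) ^ k / fact k * exp (- (\<Lambda> t - \<Lambda> s)))"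

definition claim_time :: "(real \<Rightarrow> 'a \<Rightarrow> nat) \<Rightarrow> nat \<Rightarrow> 'a \<Rightarrow> real" where
  "claim_time N j \<omega> = Inf {t. 0 \<le> t \<and> j \<le> N t \<omega>}"

text \<open>The event that at least \<open>j\<close> claims ever occur; off this event the \<open>j\<close>-th claim time is
  infinite and there is no \<open>j\<close>-th claim.\<close>

definition claim_occurs :: "'a measure \<Rightarrow> (real \<Rightarrow> 'a \<Rightarrow> nat) \<Rightarrow> nat \<Rightarrow> 'a set" where
  "claim_occurs M N j = {\<omega>\<in>space M. \<exists>t\<ge>0. j \<le> N t \<omega>}"

definition claim_size ::
    "'a measure \<Rightarrow> (real \<Rightarrow> 'a \<Rightarrow> nat) \<Rightarrow> (real \<Rightarrow> 'a \<Rightarrow> real) \<Rightarrow> nat \<Rightarrow> 'a \<Rightarrow> real" where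
  "claim_size M N Z j \<omega> = (if \<omega> \<in> claim_occurs M N j then Z (claim_time N j \<omega>) \<omega> else 0)"

text \<open>Independence of the sizes of the first \<open>n\<close> claims is understood given that these claims
  occur, under the conditional probability \<^const>\<open>uniform_measure\<close>. If almost surely infinitely
  many claims occur, this is independence of the whole sequence under \<open>M\<close>.\<close>

definition independent_claim_sizes ::
    "'a measure \<Rightarrow> (real \<Rightarrow> 'a \<Rightarrow> nat) \<Rightarrow> (real \<Rightarrow> 'a \<Rightarrow> real) \<Rightarrow> bool" where
  "independent_claim_sizes M N Z \<longleftrightarrow>
     (\<forall>n. measure M (claim_occurs M N n) > 0 \<longrightarrow>
        prob_space.indep_vars (uniform_measure M (claim_occurs M N n))
          (\<lambda>_. borel) (claim_size M N Z) {1..n})"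

subsection \<open>Probabilities of exceedance and ruin\<close>

text \<open>Suprema and infima over time are taken in the extended reals. Probabilities refer to the
  completion of \<open>M\<close>: by separability the supremum of \<open>Y\<close> is measurable only up to a subset of
  a null set.\<close>

definition prob_sup_greater ::
    "'a measure \<Rightarrow> (real \<Rightarrow> 'a \<Rightarrow> real) \<Rightarrow> real set \<Rightarrow> real \<Rightarrow> real" where
  "prob_sup_greater M X I u =
     measure (completion M) {\<omega>\<in>space M. (SUP t\<in>I. ereal (X t \<omega>)) > ereal u}"

definition ruin_event :: "'a measure \<Rightarrow> (real \<Rightarrow> 'a \<Rightarrow> real) \<Rightarrow> real set \<Rightarrow> 'a set" where
  "ruin_event M X I = {\<omega>\<in>space M. (INF t\<in>I. ereal (X t \<omega>)) < 0}"

definition ruin_prob :: "'a measure \<Rightarrow> (real \<Rightarrow> 'a \<Rightarrow> real) \<Rightarrow> real" where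
  "ruin_prob M X = measure (completion M) (ruin_event M X {0..})"

definition ruin_prob_within :: "'a measure \<Rightarrow> (real \<Rightarrow> 'a \<Rightarrow> real) \<Rightarrow> real \<Rightarrow> real" where
  "ruin_prob_within M X T = measure (completion M) (ruin_event M X {0..T})"

subsection \<open>The risk model\<close>

text \<open>\<open>R u\<close> is the risk reserve process with initial reserve \<open>u\<close>. The rates \<open>\<alpha> u\<close> and \<open>\<beta> u\<close>
  may depend on \<open>u\<close>, since they may depend on the past of the reserve. The total claim amount
  \<open>q\<close> is a general process; the principal case is \<open>q t \<omega> = (\<Sum>j=1..N t \<omega>. claim_size M N Z j \<omega>)\<close>.\<close>

locale risk_model = prob_space M
  for M :: "'a measure" +
  fixes N :: "real \<Rightarrow> 'a \<Rightarrow> nat" and \<Lambda> :: "real \<Rightarrow> real"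
    and Z :: "real \<Rightarrow> 'a \<Rightarrow> real"
    and p :: "real \<Rightarrow> real" and q :: "real \<Rightarrow> 'a \<Rightarrow> real"
    and r :: "real \<Rightarrow> real"
    and \<alpha> \<beta> :: "real \<Rightarrow> real \<Rightarrow> real \<Rightarrow> 'a \<Rightarrow> real"
    and R :: "real \<Rightarrow> real \<Rightarrow> 'a \<Rightarrow> real"
    and Y :: "real \<Rightarrow> 'a \<Rightarrow> real"
  assumes poisson: "nonhomogeneous_poisson M N \<Lambda>"
    and Lambda_0: "\<Lambda> 0 = 0"
    and Lambda_mono: "mono_on {0..} \<Lambda>"
    and Z_measurable: "\<And>t. t \<ge> 0 \<Longrightarrow> Z t \<in> borel_measurable M"
    and Z_nonneg: "\<And>t \<omega>. t \<ge> 0 \<Longrightarrow> \<omega> \<in> space M \<Longrightarrow> Z t \<omega> \<ge> 0"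
    and N_Z_independent:
      "indep_var (\<Pi>\<^sub>M t\<in>{0..}. borel) (\<lambda>\<omega>. \<lambda>t\<in>{0..}. real (N t \<omega>))
                 (\<Pi>\<^sub>M t\<in>{0..}. borel) (\<lambda>\<omega>. \<lambda>t\<in>{0..}. Z t \<omega>)"
    and claim_sizes_independent: "independent_claim_sizes M N Z"
    and p_nonneg: "\<And>t. t \<ge> 0 \<Longrightarrow> p t \<ge> 0"
    and p_mono: "mono_on {0..} p"
    and q_measurable: "\<And>t. t \<ge> 0 \<Longrightarrow> q t \<in> borel_measurable M"
    and r_0: "r 0 = 0"
    and r_mono: "mono_on {0..} r"
    and rates_measurable:
      "\<And>u s t. u > 0 \<Longrightarrow> 0 \<le> s \<Longrightarrow> s < t \<Longrightarrow>
         \<alpha> u s t \<in> borel_measurable M \<and> \<beta> u s t \<in> borel_measurable M"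
    and beta_nonneg:
      "\<And>u. u > 0 \<Longrightarrow> AE \<omega> in M. \<forall>s\<ge>0. \<forall>t>s. \<beta> u s t \<omega> \<ge> 0"
    and alpha_bound:
      "\<And>u. u > 0 \<Longrightarrow> AE \<omega> in M. \<forall>s\<ge>0. \<forall>t>s. 1 + \<alpha> u s t \<omega> \<ge> exp (r t - r s)"
    and R_measurable: "\<And>u t. u > 0 \<Longrightarrow> t \<ge> 0 \<Longrightarrow> R u t \<in> borel_measurable M"
    and R_0: "\<And>u. u > 0 \<Longrightarrow> AE \<omega> in M. R u 0 \<omega> = u"
    and R_recursion:
      "\<And>u. u > 0 \<Longrightarrow> AE \<omega> in M. \<forall>s\<ge>0. \<forall>t>s.
         R u t \<omega> = (1 + \<alpha> u s t \<omega>) * R u s \<omega> + (1 + \<beta> u s t \<omega>) * (p t - p s) - (q t \<omega> - q s \<omega>)"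
    and ruin_events_measurable:
      "\<And>u. u > 0 \<Longrightarrow> ruin_event M (R u) {0..} \<in> sets (completion M)"
      "\<And>u T. u > 0 \<Longrightarrow> T \<ge> 0 \<Longrightarrow> ruin_event M (R u) {0..T} \<in> sets (completion M)"
    and S_finite_variation:
      "AE \<omega> in M. \<forall>t\<ge>0. finite_variation_on 0 t (\<lambda>x. q x \<omega> - p x)"
    and Y_eq:
      "\<And>t \<omega>. t \<ge> 0 \<Longrightarrow> \<omega> \<in> space M \<Longrightarrow>
         Y t \<omega> = stieltjes_integral (\<lambda>x. exp (- r x)) (\<lambda>x. q x \<omega> - p x) 0 t"

locale standing_risk_model = risk_model M N \<Lambda> Z p q r \<alpha> \<beta> R Y
  for M :: "'a measure" and N \<Lambda> Z p q r \<alpha> \<beta> R Y +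
  fixes \<Lambda>' p' :: "real \<Rightarrow> real"
  assumes reserve_lower_bound:
      "\<And>u. u > 0 \<Longrightarrow> AE \<omega> in M. \<forall>t>0. exp (- r t) * R u t \<omega> \<ge> u - Y t \<omega>"
    and Y_measurable: "\<And>t. t \<ge> 0 \<Longrightarrow> Y t \<in> borel_measurable M"
    and Y_separable: "separable_process M Y"
    and Y_independent_increments: "independent_increments M Y"
    and Lambda_density: "has_density_from_0 \<Lambda> \<Lambda>'"
    and p_density: "has_density_from_0 p p'"
    and Z_moment_measurable:
      "\<And>h. h \<ge> 0 \<Longrightarrow>
         (\<lambda>x. exp_moment M (Z x) (h * exp (- r x))) \<in> borel_measurable (lebesgue_on {0..})"
    and Y_moment:
      "\<And>h t. h \<ge> 0 \<Longrightarrow> t > 0 \<Longrightarrow>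
         exp_moment M (Y t) h =
           ennreal (exp (- (LINT x:{0..t}|lebesgue. h * exp (- r x) * p' x))) *
           ennreal_exp (\<integral>\<^sup>+x\<in>{0..t}. (exp_moment M (Z x) (h * exp (- r x)) - 1) * ennreal (\<Lambda>' x) \<partial>lebesgue)"

end

theory Submission
  imports Defs
begin

text \<open>With \<open>\<phi> t = E (exp (h * Y t))\<close>, independence of increments makes
  \<open>exp (h * Y t) / \<phi> t\<close> a martingale of mean \<open>1\<close>, so Ville's maximal inequality, first for finitely
  many times and then along a separating set, bounds the probability that \<open>Y\<close> exceeds \<open>u\<close> by
  \<open>exp (- h * u) * sup \<phi>\<close>. By convexity of \<open>exp\<close> the increment condition passes from \<open>L\<close> to
  all \<open>h \<le> L\<close>, whence \<open>\<phi> (t + l) \<le> \<phi> t\<close> for \<open>t \<ge> t\<^sub>0\<close>, so \<open>sup \<phi>\<close> is determined by the times before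
  \<open>t\<^sub>0 + l\<close>. Ruin forces \<open>Y\<close> above \<open>u\<close> by the lower bound on the reserve.\<close>

subsection \<open>A maximal inequality for products of independent factors\<close>

text \<open>The sequence of partial products, frozen once it reaches \<open>c\<close>. The recursion
  tests the current value itself, so no stopping time has to be defined, and values in
  \<open>ennreal\<close> avoid integrability side conditions.\<close>

primrec stopped_prod :: "ennreal \<Rightarrow> nat \<Rightarrow> (nat \<Rightarrow> ennreal) \<Rightarrow> ennreal" where
  "stopped_prod c 0 w = 1"
| "stopped_prod c (Suc n) w =
     (if c \<le> stopped_prod c n w then stopped_prod c n w else stopped_prod c n w * w n)"

text \<open>Allows the value to be computed from the restriction of \<open>w\<close> to
  \<open>{..<n}\<close>, the form in which independence of blocks of factors is available.\<close>

lemma stopped_prod_cong: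
  "(\<And>i. i < n \<Longrightarrow> w i = w' i) \<Longrightarrow> stopped_prod c n w = stopped_prod c n w'"
  by (induction n) auto

lemma stopped_prod_measurable:
  "{..<n} \<subseteq> I \<Longrightarrow> stopped_prod c n \<in> borel_measurable (\<Pi>\<^sub>M i\<in>I. borel)"
proof (induction n)
  case 0
  have "stopped_prod c 0 = (\<lambda>_. 1)" by (simp add: fun_eq_iff)
  then show ?case by simp
next
  case (Suc n)
  have n: "n \<in> I" "{..<n} \<subseteq> I"
    using Suc.prems by auto
  have [measurable]: "stopped_prod c n \<in> borel_measurable (\<Pi>\<^sub>M i\<in>I. borel)"
    using n(2) by (rule Suc.IH)
  have [measurable]: "(\<lambda>w. w n) \<in> borel_measurable (\<Pi>\<^sub>M i\<in>I. (borel :: ennreal measure))"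
    using n(1) by measurable
  show ?case by simp
qed

text \<open>Freezing occurs only at a value of at least \<open>c\<close>; as long as the value is
  below \<open>c\<close>, every factor has been multiplied in.\<close>

lemma stopped_prod_cases:
  "c \<le> stopped_prod c n w \<or> stopped_prod c n w = (\<Prod>i<n. w i)"
  by (induction n) auto

text \<open>At stage \<open>k\<close> the value is either frozen already or equal to the full
  product. Both are at least \<open>c\<close>, and from then on the value never changes.\<close>

lemma stopped_prod_ge:
  assumes "k \<le> n" "c \<le> (\<Prod>i<k. w i)"
  shows "c \<le> stopped_prod c n w"
  using assms(1)
proof (induction rule: dec_induct)
  case base
  then show ?case using stopped_prod_cases[of c k w] assms(2) by auto
qed auto

context prob_space
begin

lemma nn_integral_mult_indep_var:
  fixes f g :: "'a \<Rightarrow> ennreal"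
  assumes "indep_var borel f borel g"
  shows "(\<integral>\<^sup>+\<omega>. f \<omega> * g \<omega> \<partial>M) = (\<integral>\<^sup>+\<omega>. f \<omega> \<partial>M) * (\<integral>\<^sup>+\<omega>. g \<omega> \<partial>M)"
proof -
  have "case_bool borel borel = (\<lambda>_. borel :: ennreal measure)"
    by (simp add: fun_eq_iff split: bool.split)
  then have "indep_vars (\<lambda>_. borel) (case_bool f g) UNIV"
    using assms by (simp add: indep_var_def)
  from indep_vars_nn_integral[OF _ this] show ?thesis
    by (simp add: UNIV_bool mult.commute)
qed

text \<open>The stopped product is a supermartingale: on the part not yet frozen, the next factor is
  independent of the past and has mean at most 1, so the expectation does not grow from one stage to
  the next.\<close>

lemma nn_integral_stopped_prod_le:
  fixes W :: "nat \<Rightarrow> 'a \<Rightarrow> ennreal"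
  assumes ind: "indep_vars (\<lambda>_. borel) W {..<n}"
    and W: "\<And>i. i < n \<Longrightarrow> (\<integral>\<^sup>+\<omega>. W i \<omega> \<partial>M) \<le> 1"
  shows "(\<integral>\<^sup>+\<omega>. stopped_prod c n (\<lambda>i. W i \<omega>) \<partial>M) \<le> 1"
  using assms
proof (induction n)
  case 0
  then show ?case by (simp add: emeasure_space_1)
next
  case (Suc n)
  let ?V = "\<lambda>w. stopped_prod c n w"
  let ?P = "\<Pi>\<^sub>M i\<in>{..<n}. (borel :: ennreal measure)"
  let ?Q = "\<Pi>\<^sub>M i\<in>{n}. (borel :: ennreal measure)"
  let ?X = "\<lambda>\<omega>. restrict (\<lambda>i. W i \<omega>) {..<n}"
  define g where "g = (\<lambda>w. if c \<le> ?V w then 0 else ?V w)"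
  define g' where "g' = (\<lambda>w. if c \<le> ?V w then ?V w else 0)"
  have [measurable]: "stopped_prod c n \<in> borel_measurable ?P"
    by (rule stopped_prod_measurable) simp
  have g [measurable]: "g \<in> borel_measurable ?P" and g' [measurable]: "g' \<in> borel_measurable ?P"
    unfolding g_def g'_def by measurable
  have V_eq: "?V (?X \<omega>) = ?V (\<lambda>i. W i \<omega>)" for \<omega>
    by (rule stopped_prod_cong) simp
  have X [measurable]: "?X \<in> measurable M ?P"
    using Suc.prems(1) by (intro measurable_restrict) (auto simp: indep_vars_def)
  \<comment> \<open>The index blocks \<open>{..<n}\<close> and \<open>{n}\<close> are disjoint, so
    every measurable function of the first \<open>n\<close> factors, in particular \<open>g\<close>,
    is independent of \<open>W n\<close>.\<close>
  have "indep_var ?P ?X ?Q (\<lambda>\<omega>. restrict (\<lambda>i. W i \<omega>) {n})"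
    by (rule indep_var_restrict[OF Suc.prems(1)]) auto
  from indep_var_compose[OF this g, of "\<lambda>w. w n" borel]
  have indep: "indep_var borel (\<lambda>\<omega>. g (?X \<omega>)) borel (W n)"
    by (simp add: comp_def)
  have [measurable]: "W n \<in> borel_measurable M"
    using Suc.prems(1) by (auto simp: indep_vars_def)
  have "(\<integral>\<^sup>+\<omega>. stopped_prod c (Suc n) (\<lambda>i. W i \<omega>) \<partial>M)
      = (\<integral>\<^sup>+\<omega>. g' (?X \<omega>) + g (?X \<omega>) * W n \<omega> \<partial>M)"
    by (intro nn_integral_cong) (simp add: g_def g'_def V_eq)
  also have "\<dots> = (\<integral>\<^sup>+\<omega>. g' (?X \<omega>) \<partial>M) + (\<integral>\<^sup>+\<omega>. g (?X \<omega>) * W n \<omega> \<partial>M)"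
    by (intro nn_integral_add) measurable
  also have "\<dots> \<le> (\<integral>\<^sup>+\<omega>. g' (?X \<omega>) \<partial>M) + (\<integral>\<^sup>+\<omega>. g (?X \<omega>) \<partial>M)"
    using mult_left_mono[OF Suc.prems(2)[of n], of "\<integral>\<^sup>+\<omega>. g (?X \<omega>) \<partial>M"]
    by (auto simp: nn_integral_mult_indep_var[OF indep] intro!: add_left_mono)
  also have "\<dots> = (\<integral>\<^sup>+\<omega>. g' (?X \<omega>) + g (?X \<omega>) \<partial>M)"
    by (intro nn_integral_add[symmetric]) measurable
  also have "\<dots> = (\<integral>\<^sup>+\<omega>. ?V (\<lambda>i. W i \<omega>) \<partial>M)"
    by (intro nn_integral_cong) (simp add: g_def g'_def V_eq)
  also have "\<dots> \<le> 1"
    using Suc.prems by (intro Suc.IH indep_vars_subset[OF Suc.prems(1)]) auto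
  finally show ?case .
qed

text \<open>Markov's inequality for the stopped product, which ends at or above \<open>c\<close>
  whenever some partial product reaches \<open>c\<close>. Multiplying by \<open>c\<close> avoids a
  division in \<open>ennreal\<close>.\<close>

lemma maximal_inequality_prod:
  fixes W :: "nat \<Rightarrow> 'a \<Rightarrow> ennreal"
  assumes ind: "indep_vars (\<lambda>_. borel) W {..<n}"
    and W: "\<And>i. i < n \<Longrightarrow> (\<integral>\<^sup>+\<omega>. W i \<omega> \<partial>M) \<le> 1"
  shows "c * emeasure M {\<omega>\<in>space M. \<exists>k\<le>n. c \<le> (\<Prod>i<k. W i \<omega>)} \<le> 1"
proof -
  let ?G = "\<lambda>\<omega>. stopped_prod c n (\<lambda>i. W i \<omega>)"
  have "(\<lambda>\<omega>. stopped_prod c n (restrict (\<lambda>i. W i \<omega>) {..<n})) \<in> borel_measurable M"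
    using ind by (intro measurable_compose[OF measurable_restrict stopped_prod_measurable])
      (auto simp: indep_vars_def)
  also have "(\<lambda>\<omega>. stopped_prod c n (restrict (\<lambda>i. W i \<omega>) {..<n})) = ?G"
    by (intro ext stopped_prod_cong) simp
  finally have [measurable]: "?G \<in> borel_measurable M" .
  have "c * emeasure M {\<omega>\<in>space M. \<exists>k\<le>n. c \<le> (\<Prod>i<k. W i \<omega>)}
      \<le> c * emeasure M {\<omega>\<in>space M. c \<le> ?G \<omega>}"
    by (intro mult_left_mono emeasure_mono) (auto intro: stopped_prod_ge)
  also have "\<dots> = (\<integral>\<^sup>+\<omega>. c * indicator {\<omega>\<in>space M. c \<le> ?G \<omega>} \<omega> \<partial>M)"
    by (subst nn_integral_cmult_indicator) auto
  also have "\<dots> \<le> (\<integral>\<^sup>+\<omega>. ?G \<omega> \<partial>M)"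
    by (intro nn_integral_mono) (auto split: split_indicator)
  also have "\<dots> \<le> 1"
    using assms by (rule nn_integral_stopped_prod_le)
  finally show ?thesis .
qed

end

subsection \<open>Exponential moments of processes with independent increments\<close>

text \<open>A vanishing integral would force the strictly positive exponential to vanish almost
  surely. Positivity permits normalising by this moment later.\<close>

lemma (in prob_space) exp_moment_pos:
  assumes [measurable]: "X \<in> borel_measurable M"
  shows "exp_moment M X h > 0"
proof (rule ccontr)
  assume "\<not> 0 < exp_moment M X h"
  then have "AE \<omega> in M. ennreal (exp (h * X \<omega>)) = 0"
    by (simp add: exp_moment_def nn_integral_0_iff_AE)
  then show False by (simp add: ennreal_eq_0_iff not_le)
qed

text \<open>By convexity, \<open>exp (h * x)\<close> lies below the chord of \<open>exp\<close>
  between 0 and \<open>L * x\<close>, with weight \<open>h / L\<close>. Taking expectations bounds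
  the moment at \<open>h\<close> by a convex combination of 1 and the moment at
  \<open>L\<close>.\<close>

lemma (in prob_space) exp_moment_le_1_antimono:
  assumes [measurable]: "X \<in> borel_measurable M"
    and h: "0 \<le> h" "h \<le> L" "0 < L" and L: "exp_moment M X L \<le> 1"
  shows "exp_moment M X h \<le> 1"
proof -
  have convex: "exp (h * x) \<le> (1 - h / L) + h / L * exp (L * x)" for x :: real
    using convex_onD[OF exp_convex, of "h / L" 0 "L * x"] h by simp
  have "exp_moment M X h
      \<le> (\<integral>\<^sup>+\<omega>. ennreal (1 - h / L) + ennreal (h / L) * ennreal (exp (L * X \<omega>)) \<partial>M)"
    unfolding exp_moment_def using h convex
    by (intro nn_integral_mono)
      (simp add: ennreal_mult[symmetric] ennreal_plus[symmetric] del: ennreal_plus)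
  also have "\<dots> = ennreal (1 - h / L) + ennreal (h / L) * exp_moment M X L"
    by (simp add: nn_integral_add nn_integral_cmult emeasure_space_1 exp_moment_def)
  also have "\<dots> \<le> ennreal (1 - h / L) + ennreal (h / L) * 1"
    using L by (intro add_left_mono mult_left_mono) auto
  also have "\<dots> = 1"
    using h by (simp add: ennreal_plus[symmetric] del: ennreal_plus)
  finally show ?thesis .
qed

text \<open>Puts a finite set of times into the form used by \<open>independent_increments\<close>.
  Starting at 0 makes the increments up to index \<open>k\<close> add up to the process at time
  \<open>s k\<close>, when the process starts at 0.\<close>

lemma finite_times_enumerate:
  fixes F :: "real set"
  assumes "finite F" "0 \<in> F" "F \<subseteq> {0..}"
  obtains s :: "nat \<Rightarrow> real" and n
  where "s 0 = 0" "\<And>i. i < n \<Longrightarrow> s i \<le> s (Suc i)" "s ` {..n} = F"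
proof
  define xs where "xs = sorted_list_of_set F"
  have xs: "sorted xs" "set xs = F" using assms by (auto simp: xs_def)
  then have ne: "xs \<noteq> []" using assms by auto
  show F: "(!) xs ` {..length xs - 1} = F"
    using ne xs(2) by (auto simp: set_conv_nth image_iff Suc_le_eq dest: less_imp_diff_less)
       (metis Suc_pred length_greater_0_conv less_Suc_eq_le)
  show "xs ! i \<le> xs ! Suc i" if "i < length xs - 1" for i
    using sorted_nth_mono[OF xs(1), of i "Suc i"] that by simp
  obtain k where "k < length xs" "xs ! k = 0" using assms xs by (metis in_set_conv_nth)
  moreover have "xs ! 0 \<in> F" using ne xs by auto
  ultimately show "xs ! 0 = 0"
    using sorted_nth_mono[OF xs(1), of 0 k] assms(3) by force
qed

lemma exceedance_sets:
  fixes X :: "real \<Rightarrow> 'a \<Rightarrow> real"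
  assumes "countable S" "\<And>t. t \<in> S \<Longrightarrow> X t \<in> borel_measurable M"
  shows "{\<omega>\<in>space M. \<exists>t\<in>S. u < X t \<omega>} \<in> sets M"
proof -
  have "{\<omega>\<in>space M. \<exists>t\<in>S. u < X t \<omega>} = (\<Union>t\<in>S. {\<omega>\<in>space M. u < X t \<omega>})"
    by auto
  also have "\<dots> \<in> sets M"
    using assms by (intro sets.countable_UN') (auto intro: borel_measurable_less)
  finally show ?thesis .
qed

section \<open>Processes with independent increments started at 0: exceedance over finite and
  countable sets of times\<close>

locale increment_process = prob_space M
  for M :: "'a measure" +
  fixes X :: "real \<Rightarrow> 'a \<Rightarrow> real"
  assumes X_measurable: "\<And>t. t \<ge> 0 \<Longrightarrow> X t \<in> borel_measurable M"
    and X_0: "\<And>\<omega>. \<omega> \<in> space M \<Longrightarrow> X 0 \<omega> = 0"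
    and X_increments: "independent_increments M X"
begin

lemma exp_moment_0: "exp_moment M (X 0) h = 1"
proof -
  have "exp_moment M (X 0) h = (\<integral>\<^sup>+\<omega>. 1 \<partial>M)"
    unfolding exp_moment_def by (intro nn_integral_cong) (simp add: X_0)
  then show ?thesis by (simp add: emeasure_space_1)
qed

text \<open>Since \<open>X 0 = 0\<close>, the increments over the times 0, \<open>s\<close>,
  \<open>t\<close> are \<open>X s\<close> and \<open>X t - X s\<close>. Their independence factors
  the moment, and in \<open>ennreal\<close> this includes infinite moments.\<close>

lemma exp_moment_increment:
  assumes st: "0 \<le> s" "s \<le> t"
  shows "exp_moment M (X t) h = exp_moment M (X s) h * exp_moment M (\<lambda>\<omega>. X t \<omega> - X s \<omega>) h"
proof -
  define v where "v = (\<lambda>i::nat. if i = 0 then 0 else if i = 1 then s else t)"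
  have "\<forall>i<2. v i \<le> v (Suc i)" "0 \<le> v 0"
    using st by (auto simp: v_def)
  then have "indep_vars (\<lambda>_. borel) (\<lambda>i \<omega>. X (v (Suc i)) \<omega> - X (v i) \<omega>) {..<2}"
    using X_increments unfolding independent_increments_def by blast
  from indep_vars_compose2[OF this, of "\<lambda>_ x. ennreal (exp (h * x))" "\<lambda>_. borel"]
  have "indep_vars (\<lambda>_. borel) (\<lambda>i \<omega>. ennreal (exp (h * (X (v (Suc i)) \<omega> - X (v i) \<omega>)))) {..<2}"
    by simp
  from indep_vars_nn_integral[OF _ this]
  have "(\<integral>\<^sup>+\<omega>. ennreal (exp (h * (X s \<omega> - X 0 \<omega>))) * ennreal (exp (h * (X t \<omega> - X s \<omega>))) \<partial>M)
     = (\<integral>\<^sup>+\<omega>. ennreal (exp (h * (X s \<omega> - X 0 \<omega>))) \<partial>M)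
       * (\<integral>\<^sup>+\<omega>. ennreal (exp (h * (X t \<omega> - X s \<omega>))) \<partial>M)"
    by (simp add: numeral_2_eq_2 v_def)
  moreover have "(\<integral>\<^sup>+\<omega>. ennreal (exp (h * (X s \<omega> - X 0 \<omega>))) * ennreal (exp (h * (X t \<omega> - X s \<omega>))) \<partial>M)
     = exp_moment M (X t) h"
    unfolding exp_moment_def
    by (intro nn_integral_cong)
      (simp add: X_0 ennreal_mult[symmetric] exp_add[symmetric] algebra_simps)
  moreover have "(\<integral>\<^sup>+\<omega>. ennreal (exp (h * (X s \<omega> - X 0 \<omega>))) \<partial>M) = exp_moment M (X s) h"
    unfolding exp_moment_def by (intro nn_integral_cong) (simp add: X_0)
  ultimately show ?thesis
    by (simp add: exp_moment_def)
qed

text \<open>Dividing \<open>exp (h * X t)\<close> by its mean gives a martingale, which along the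
  enumerated times is a product of independent factors of mean 1. An exceedance of \<open>u\<close>
  makes it at least \<open>exp (h * u) / B\<close>, and the maximal inequality applies.\<close>

lemma exceedance_finite:
  assumes F: "finite F" "0 \<in> F" "F \<subseteq> {0..}" and h: "h \<ge> 0"
    and B: "\<And>t. t \<in> F \<Longrightarrow> exp_moment M (X t) h \<le> ennreal B"
  shows "emeasure M {\<omega>\<in>space M. \<exists>t\<in>F. u < X t \<omega>} \<le> ennreal (exp (- h * u) * B)"
proof -
  obtain s n where s: "s 0 = 0" "\<And>i. i < n \<Longrightarrow> s i \<le> s (Suc i)" "s ` {..n} = F"
    using finite_times_enumerate[OF F] by metis
  have s_nn: "0 \<le> s i" if "i \<le> n" for i
    using that s(3) F(3) by auto
  define f where "f t = enn2real (exp_moment M (X t) h)" for t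
  \<comment> \<open>Time 0 belongs to \<open>F\<close> and has moment 1. This makes \<open>B\<close>
    positive, so that it can be cancelled below.\<close>
  have B1: "1 \<le> B"
    using B[OF F(2)] by (simp add: exp_moment_0)
  have f: "exp_moment M (X (s i)) h = ennreal (f (s i))" "0 < f (s i)" "f (s i) \<le> B"
    if "i \<le> n" for i
  proof -
    have le: "exp_moment M (X (s i)) h \<le> ennreal B" using B s(3) that by auto
    then have fin: "exp_moment M (X (s i)) h < \<top>"
      using ennreal_less_top le_less_trans by blast
    then show "exp_moment M (X (s i)) h = ennreal (f (s i))"
      by (simp add: f_def)
    show "0 < f (s i)"
      using exp_moment_pos[OF X_measurable[OF s_nn[OF that]], of h] fin
      by (simp add: f_def enn2real_positive_iff)
    show "f (s i) \<le> B"
      unfolding f_def using enn2real_leI[OF _ le] B1 by simp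
  qed
  \<comment> \<open>The quotient of moments normalises the exponential of the increment to mean 1
    and makes the products telescope.\<close>
  define w where "w = (\<lambda>i x. exp (h * x) * f (s i) / f (s (Suc i)))"
  define W where "W = (\<lambda>i \<omega>. ennreal (w i (X (s (Suc i)) \<omega> - X (s i) \<omega>)))"
  have "indep_vars (\<lambda>_. borel) (\<lambda>i \<omega>. X (s (Suc i)) \<omega> - X (s i) \<omega>) {..<n}"
    using X_increments s unfolding independent_increments_def by simp
  from indep_vars_compose2[OF this, of "\<lambda>i x. ennreal (w i x)" "\<lambda>_. borel"]
  have ind: "indep_vars (\<lambda>_. borel) W {..<n}"
    by (simp add: W_def w_def)
  have "(\<integral>\<^sup>+\<omega>. W i \<omega> \<partial>M) \<le> 1" if "i < n" for i
  proof -
    have [measurable]: "X (s i) \<in> borel_measurable M" "X (s (Suc i)) \<in> borel_measurable M"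
      using that by (auto intro!: X_measurable s_nn)
    have pos: "0 < f (s i)" "0 < f (s (Suc i))" using f(2) that by auto
    let ?a = "exp_moment M (\<lambda>\<omega>. X (s (Suc i)) \<omega> - X (s i) \<omega>) h"
    have "(\<integral>\<^sup>+\<omega>. W i \<omega> \<partial>M) = (\<integral>\<^sup>+\<omega>. ennreal (f (s i) / f (s (Suc i)))
        * ennreal (exp (h * (X (s (Suc i)) \<omega> - X (s i) \<omega>))) \<partial>M)"
      using pos unfolding W_def w_def
      by (intro nn_integral_cong) (simp add: ennreal_mult[symmetric] mult.commute)
    also have "\<dots> = ennreal (1 / f (s (Suc i))) * (ennreal (f (s i)) * ?a)"
      using pos
      by (subst nn_integral_cmult)
        (simp_all add: exp_moment_def mult.assoc[symmetric] ennreal_mult[symmetric])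
    also have "ennreal (f (s i)) * ?a = ennreal (f (s (Suc i)))"
      using exp_moment_increment[of "s i" "s (Suc i)" h] s s_nn[of i] f(1)[of i] f(1)[of "Suc i"] that
      by simp
    also have "ennreal (1 / f (s (Suc i))) * \<dots> = 1"
      using pos by (simp add: ennreal_mult[symmetric])
    finally show ?thesis by simp
  qed
  note max = maximal_inequality_prod[OF ind this, of "ennreal (exp (h * u) / B)"]
  \<comment> \<open>Telescoping: the moments between times 0 and \<open>s k\<close> cancel, and at
    time 0 both \<open>exp (h * X 0)\<close> and the moment equal 1.\<close>
  have prod: "(\<Prod>i<k. W i \<omega>) = ennreal (exp (h * X (s k) \<omega>) / f (s k))"
    if "k \<le> n" "\<omega> \<in> space M" for k \<omega>
    using that(1)
  proof (induction k)
    case 0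
    have "f (s 0) = 1" by (simp add: f_def s exp_moment_0)
    then show ?case using that s by (simp add: X_0)
  next
    case (Suc k)
    then have pos: "0 < f (s k)" "0 < f (s (Suc k))" using f(2) by auto
    have "(\<Prod>i<Suc k. W i \<omega>) = ennreal (exp (h * X (s k) \<omega>) / f (s k)) * W k \<omega>"
      using Suc by simp
    also have "\<dots> = ennreal (exp (h * X (s k) \<omega>) / f (s k) * w k (X (s (Suc k)) \<omega> - X (s k) \<omega>))"
      using pos unfolding W_def by (intro ennreal_mult[symmetric]) (auto simp: w_def)
    also have "exp (h * X (s k) \<omega>) / f (s k) * w k (X (s (Suc k)) \<omega> - X (s k) \<omega>)
        = exp (h * X (s (Suc k)) \<omega>) / f (s (Suc k))"
      using pos by (simp add: w_def exp_diff right_diff_distrib)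
    finally show ?case .
  qed
  let ?A = "{\<omega>\<in>space M. \<exists>t\<in>F. u < X t \<omega>}"
  let ?H = "{\<omega>\<in>space M. \<exists>k\<le>n. ennreal (exp (h * u) / B) \<le> (\<Prod>i<k. W i \<omega>)}"
  have "?A \<subseteq> ?H"
  proof clarify
    fix \<omega> t assume \<omega>: "\<omega> \<in> space M" and t: "t \<in> F" "u < X t \<omega>"
    then obtain k where k: "k \<le> n" "t = s k" using s(3) by auto
    \<comment> \<open>The numerator grows because \<open>u < X t\<close> and
      \<open>h \<ge> 0\<close>; the denominator \<open>f (s k)\<close> is positive and at most
      \<open>B\<close>.\<close>
    have "exp (h * u) / B \<le> exp (h * X (s k) \<omega>) / f (s k)"
      using f(2,3)[OF k(1)] t k h by (intro frac_le) (auto intro: mult_left_mono)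
    then show "\<exists>k\<le>n. ennreal (exp (h * u) / B) \<le> (\<Prod>i<k. W i \<omega>)"
      using k \<omega> by (intro exI[of _ k]) (simp add: prod ennreal_leI)
  qed
  moreover have "?H \<in> sets M"
  proof -
    have [measurable]: "W i \<in> borel_measurable M" if "i < n" for i
      using ind that by (auto simp: indep_vars_def)
    have [measurable]: "(\<lambda>\<omega>. \<Prod>i<k. W i \<omega>) \<in> borel_measurable M" if "k \<le> n" for k
      using that by (intro borel_measurable_prod_ennreal) auto
    have "?H = (\<Union>k\<in>{..n}. {\<omega>\<in>space M. ennreal (exp (h * u) / B) \<le> (\<Prod>i<k. W i \<omega>)})"
      by auto
    also have "\<dots> \<in> sets M"
      by (intro sets.finite_UN) auto
    finally show ?thesis .
  qed
  ultimately have "emeasure M ?A \<le> emeasure M ?H" by (rule emeasure_mono)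
  also have "\<dots> = ennreal (exp (- h * u) * B) * (ennreal (exp (h * u) / B) * emeasure M ?H)"
    using B1 by (simp add: mult.assoc[symmetric] ennreal_mult[symmetric] exp_minus field_simps)
  also have "\<dots> \<le> ennreal (exp (- h * u) * B)"
    using mult_left_mono[OF max, of "ennreal (exp (- h * u) * B)"] by simp
  finally show ?thesis .
qed

text \<open>Continuity from below: finite sets of times increase to \<open>D\<close> together with
  0, and the finite bound is uniform because every moment involved is at most the supremum over
  \<open>T\<close>.\<close>

lemma exceedance_countable:
  assumes D: "countable D" "D \<subseteq> T" and T: "0 \<in> T" "T \<subseteq> {0..}" and h: "h \<ge> 0"
  shows "emeasure M {\<omega>\<in>space M. \<exists>t\<in>D. u < X t \<omega>}
    \<le> ennreal (exp (- h * u)) * (SUP t\<in>T. exp_moment M (X t) h)"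
proof (cases "(SUP t\<in>T. exp_moment M (X t) h) = \<top>")
  \<comment> \<open>The factor \<open>exp (- h * u)\<close> is positive, so the right-hand side is
    infinite.\<close>
  case True
  show ?thesis unfolding True by (simp add: ennreal_mult_top)
next
  case False
  then obtain B where B: "0 \<le> B" "(SUP t\<in>T. exp_moment M (X t) h) = ennreal B"
    by (metis ennreal_enn2real enn2real_nonneg top.not_eq_extremum)
  have le_B: "exp_moment M (X t) h \<le> ennreal B" if "t \<in> T" for t
    unfolding B(2)[symmetric] using that by (rule SUP_upper)
  \<comment> \<open>Adding 0 makes the set nonempty, as the enumeration \<open>from_nat_into\<close>
    requires. Each \<open>F n\<close> also contains 0, as the finite bound requires.\<close>
  define D' where "D' = insert 0 D"
  have D': "countable D'" "D' \<noteq> {}" "D' \<subseteq> T" using D T by (auto simp: D'_def)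
  define F where "F n = insert 0 (from_nat_into D' ` {..n})" for n :: nat
  have F_sub: "F n \<subseteq> T" for n
    using T(1) D' from_nat_into[OF D'(2)] by (auto simp: F_def)
  have F: "(\<Union>n. F n) = D'"
  proof -
    have "D' = range (from_nat_into D')" using D' by (simp add: range_from_nat_into)
    then show ?thesis by (auto simp: F_def D'_def)
  qed
  let ?A = "\<lambda>S. {\<omega>\<in>space M. \<exists>t\<in>S. u < X t \<omega>}"
  have A_sets: "?A S \<in> sets M" if "countable S" "S \<subseteq> T" for S
    using that T by (intro exceedance_sets) (auto intro!: X_measurable)
  have F_events: "range (\<lambda>n. ?A (F n)) \<subseteq> sets M"
  proof (intro image_subsetI A_sets F_sub)
    show "countable (F n)" for n by (simp add: F_def countable_finite)
  qed
  have "F m \<subseteq> F n" if "m \<le> n" for m n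
    using that by (auto simp: F_def)
  then have inc: "incseq (\<lambda>n. ?A (F n))"
    unfolding incseq_def by blast
  have "?A D \<subseteq> ?A (\<Union>n. F n)"
    unfolding F D'_def by blast
  also have "\<dots> = (\<Union>n. ?A (F n))" by blast
  finally have "emeasure M (?A D) \<le> emeasure M (\<Union>n. ?A (F n))"
    using F_events by (intro emeasure_mono sets.countable_UN)
  also have "\<dots> = (SUP n. emeasure M (?A (F n)))"
    using F_events inc by (rule SUP_emeasure_incseq[symmetric])
  also have "\<dots> \<le> ennreal (exp (- h * u) * B)"
    using F_sub T le_B h
    by (intro SUP_least exceedance_finite) (auto simp: F_def)
  finally show ?thesis
    using B by (simp add: ennreal_mult)
qed

end

subsection \<open>Passage to continuous time\<close>

text \<open>Every piece of a tagged division of \<open>{a..a}\<close> is \<open>{a}\<close>, so all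
  Stieltjes sums vanish. The equivalence includes uniqueness of the value, which the definite
  description in \<open>stieltjes_integral\<close> needs to give \<open>Y 0 = 0\<close>.\<close>

lemma has_stieltjes_integral_degenerate:
  "has_stieltjes_integral f g a a y \<longleftrightarrow> y = 0"
proof
  have zero: "(\<Sum>(x, K)\<in>\<D>. f x * (g (Sup K) - g (Inf K))) = 0"
    if "\<D> tagged_division_of {a..a}" for \<D>
  proof (intro sum.neutral ballI, clarify)
    fix x K assume "(x, K) \<in> \<D>"
    with that have "x \<in> K" "K \<subseteq> {a}" by auto
    then have "K = {a}" by blast
    then show "f x * (g (Sup K) - g (Inf K)) = 0" by simp
  qed
  show "has_stieltjes_integral f g a a y" if "y = 0"
    unfolding has_stieltjes_integral_def using zero that by (auto intro!: gauge_trivial)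
  assume y: "has_stieltjes_integral f g a a y"
  have "\<bar>y\<bar> < e" if e: "e > 0" for e
  proof -
    obtain \<gamma> where \<gamma>: "gauge \<gamma> \<and> (\<forall>\<D>. \<D> tagged_division_of {a..a} \<and> \<gamma> fine \<D> \<longrightarrow>
        \<bar>(\<Sum>(x, K)\<in>\<D>. f x * (g (Sup K) - g (Inf K))) - y\<bar> < e)"
      using y[unfolded has_stieltjes_integral_def, rule_format, OF e] ..
    \<comment> \<open>Existence of a fine division (Cousin's lemma) keeps the defining condition
      from being vacuous and so gives uniqueness.\<close>
    obtain \<D> where "\<D> tagged_division_of {a..a}" "\<gamma> fine \<D>"
      using fine_division_exists_real[OF \<gamma>[THEN conjunct1]] by blast
    with \<gamma>[THEN conjunct2, rule_format, of \<D>] zero[of \<D>] show ?thesis by simp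
  qed
  from this[of "\<bar>y\<bar>"] show "y = 0" by auto
qed

text \<open>Separability controls open intervals only. The countable set \<open>K\<close> adds the
  remaining times, such as the right endpoint of \<open>{0..T}\<close>. The exceptional set
  \<open>E\<close> serves all levels \<open>u\<close> at once.\<close>

lemma separable_process_exceedance:
  assumes sep: "separable_process M X"
    and I: "open I" "is_interval I" and J: "J = (I \<inter> {0..}) \<union> K" "K \<subseteq> {0..}" "countable K"
  obtains D E where "countable D" "D \<subseteq> J" "E \<in> null_sets M"
    "\<And>u \<omega>. \<omega> \<in> space M - E \<Longrightarrow> (\<exists>t\<in>J. u < X t \<omega>) \<longleftrightarrow> (\<exists>t\<in>D. u < X t \<omega>)"
proof -
  obtain D E where D: "countable D" "D \<subseteq> {0..}" "E \<in> null_sets M"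
    and sub: "\<forall>A I. closed A \<and> is_interval A \<and> open I \<and> is_interval I \<longrightarrow>
       {\<omega>\<in>space M. \<forall>t\<in>I \<inter> D. X t \<omega> \<in> A} \<subseteq> {\<omega>\<in>space M. \<forall>t\<in>I \<inter> {0..}. X t \<omega> \<in> A} \<union> E"
    using sep unfolding separable_process_def by (elim exE conjE)
  show thesis
  proof (rule that[of "(I \<inter> D) \<union> K" E])
    fix u \<omega> assume \<omega>: "\<omega> \<in> space M - E"
    show "(\<exists>t\<in>J. u < X t \<omega>) \<longleftrightarrow> (\<exists>t\<in>(I \<inter> D) \<union> K. u < X t \<omega>)"
    proof
      assume "\<exists>t\<in>J. u < X t \<omega>"
      \<comment> \<open>Separability is applied to the closed infinite interval
        \<open>{..u}\<close>: staying at or below \<open>u\<close> on \<open>I \<inter> D\<close>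
        carries over to all nonnegative times in \<open>I\<close>.\<close>
      moreover have "\<forall>t\<in>I \<inter> {0..}. X t \<omega> \<le> u" if "\<forall>t\<in>I \<inter> D. X t \<omega> \<le> u"
        using sub[rule_format, of "{..u}" I] I \<omega> that by (auto simp: is_interval_ic)
      ultimately show "\<exists>t\<in>(I \<inter> D) \<union> K. u < X t \<omega>"
        unfolding J(1) by (meson Un_iff not_le)
    next
      assume "\<exists>t\<in>(I \<inter> D) \<union> K. u < X t \<omega>"
      then show "\<exists>t\<in>J. u < X t \<omega>"
        using D(2) J(1) by blast
    qed
  qed (use D J in auto)
qed

text \<open>The supremum event and the exceedance event along a countable set differ only inside a
  null set, so the former is measurable for the completion and has the same probability.\<close>

lemma prob_sup_greater_countable:
  fixes X :: "real \<Rightarrow> 'a \<Rightarrow> real"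
  assumes "separable_process M X" and X: "\<And>t. t \<ge> 0 \<Longrightarrow> X t \<in> borel_measurable M"
    and I: "open I" "is_interval I" and J: "J = (I \<inter> {0..}) \<union> K" "K \<subseteq> {0..}" "countable K"
  obtains D where "countable D" "D \<subseteq> J"
    "{\<omega>\<in>space M. (SUP t\<in>J. ereal (X t \<omega>)) > ereal u} \<in> sets (completion M)"
    "prob_sup_greater M X J u = measure M {\<omega>\<in>space M. \<exists>t\<in>D. u < X t \<omega>}"
proof -
  obtain D E where D: "countable D" "D \<subseteq> J" "E \<in> null_sets M"
    and iff: "\<And>u \<omega>. \<omega> \<in> space M - E \<Longrightarrow> (\<exists>t\<in>J. u < X t \<omega>) \<longleftrightarrow> (\<exists>t\<in>D. u < X t \<omega>)"
    using separable_process_exceedance[OF assms(1) I J] by metis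
  let ?S = "{\<omega>\<in>space M. (SUP t\<in>J. ereal (X t \<omega>)) > ereal u}"
  let ?A = "{\<omega>\<in>space M. \<exists>t\<in>D. u < X t \<omega>}"
  have D0: "t \<ge> 0" if "t \<in> D" for t
    using that D(2) J by auto
  have A: "?A \<in> sets M"
    using D(1) D0 X by (intro exceedance_sets) auto
  \<comment> \<open>The inequality is strict, so the supremum exceeds \<open>u\<close> exactly when
    some single value does.\<close>
  have S_eq: "?S = {\<omega>\<in>space M. \<exists>t\<in>J. u < X t \<omega>}"
    by (auto simp: less_SUP_iff)
  have "?A \<subseteq> ?S" "?S - ?A \<subseteq> E"
    unfolding S_eq using D(2) iff by blast+
  then have "?S = ?A \<union> (?S - ?A)" "?S - ?A \<in> null_sets (completion M)"
    using D(3) unfolding null_sets_completion_iff2 by blast+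
  then obtain N where S: "?S = ?A \<union> N" and N: "N \<in> null_sets (completion M)" ..
  have "?S \<in> sets (completion M)"
    unfolding S using A N by (auto intro: sets_completionI_sets)
  moreover have "measure (completion M) ?S = measure M ?A"
    unfolding S using A N by (simp add: measure_Un_null_set sets_completionI_sets)
  ultimately show thesis
    by (intro that[OF D(1,2)]) (simp_all add: prob_sup_greater_def)
qed

section \<open>Exceedance and ruin in the risk model\<close>

lemma (in standing_risk_model) Y_0: "\<omega> \<in> space M \<Longrightarrow> Y 0 \<omega> = 0"
  by (simp add: Y_eq stieltjes_integral_def has_stieltjes_integral_degenerate)

sublocale standing_risk_model \<subseteq> increment_process M Y
  by unfold_locales (auto intro: Y_measurable Y_0 Y_independent_increments)

context standing_risk_model
begin

lemma exceedance_bound: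
  assumes I: "open I" "is_interval I" and J: "J = (I \<inter> {0..}) \<union> K" "K \<subseteq> {0..}" "countable K"
    and "0 \<in> J" "h \<ge> 0"
  shows "ennreal (prob_sup_greater M Y J u)
    \<le> ennreal (exp (- h * u)) * (SUP t\<in>J. exp_moment M (Y t) h)"
proof -
  obtain D where "countable D" "D \<subseteq> J"
    "prob_sup_greater M Y J u = measure M {\<omega>\<in>space M. \<exists>t\<in>D. u < Y t \<omega>}"
    by (rule prob_sup_greater_countable[OF Y_separable Y_measurable I J])
  then show ?thesis
    using assms exceedance_countable[of D J h u] by (auto simp: emeasure_eq_measure)
qed

text \<open>Almost surely, a negative reserve at time \<open>t\<close> makes the discounted reserve
  negative, and its lower bound \<open>u - Y t\<close> is then negative too, so \<open>Y\<close>
  exceeds \<open>u\<close> at that time.\<close>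

lemma ruin_le_exceedance:
  assumes I: "open I" "is_interval I" and J: "J = (I \<inter> {0..}) \<union> K" "K \<subseteq> {0..}" "countable K"
    and u: "u > 0"
  shows "measure (completion M) (ruin_event M (R u) J) \<le> prob_sup_greater M Y J u"
proof -
  let ?S = "{\<omega>\<in>space M. (SUP t\<in>J. ereal (Y t \<omega>)) > ereal u}"
  have S: "?S \<in> sets (completion M)"
    using prob_sup_greater_countable[OF Y_separable Y_measurable I J] by metis
  interpret C: prob_space "completion M"
    by (rule prob_space_completion)
  have "AE \<omega> in M. \<omega> \<in> ruin_event M (R u) J \<longrightarrow> \<omega> \<in> ?S"
    using reserve_lower_bound[OF u] R_0[OF u]
  proof eventually_elim
    case (elim \<omega>)
    show ?case
    proof
      assume "\<omega> \<in> ruin_event M (R u) J"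
      then obtain t where t: "\<omega> \<in> space M" "t \<in> J" "R u t \<omega> < 0"
        by (auto simp: ruin_event_def INF_less_iff)
      \<comment> \<open>The lower bound on the reserve covers \<open>t > 0\<close> only; time 0 is
        excluded because the reserve starts at \<open>u > 0\<close> almost surely.\<close>
      moreover have "t \<noteq> 0" using t elim u by auto
      ultimately have "t > 0" using J by auto
      then have "u - Y t \<omega> < 0"
        using elim t by (smt (verit) exp_gt_zero mult_pos_neg)
      then show "\<omega> \<in> ?S"
        using t by (auto simp: less_SUP_iff)
    qed
  qed
  then have "AE \<omega> in completion M. \<omega> \<in> ruin_event M (R u) J \<longrightarrow> \<omega> \<in> ?S"
    by (rule AE_completion)
  then show ?thesis
    unfolding prob_sup_greater_def using S by (rule C.finite_measure_mono_AE)
qed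

text \<open>From \<open>t\<^sub>0\<close> on, an increment over a period \<open>l\<close> has moment
  at most 1, so a step of \<open>l\<close> does not increase the moment. Going back in steps of
  \<open>l\<close> brings every time below \<open>t\<^sub>0 + l\<close>.\<close>

lemma SUP_exp_moment_eq:
  assumes "l > 0" "t\<^sub>0 > 0" and h: "0 \<le> h" "h \<le> L" "0 < L"
    and incr: "\<And>t. t \<ge> t\<^sub>0 \<Longrightarrow> exp_moment M (\<lambda>\<omega>. Y (t + l) \<omega> - Y t \<omega>) L \<le> 1"
  shows "(SUP t\<in>{0..}. exp_moment M (Y t) h) = (SUP t\<in>{0..<t\<^sub>0 + l}. exp_moment M (Y t) h)"
    (is "_ = ?S")
proof (rule antisym)
  have step: "exp_moment M (Y (t + l)) h \<le> exp_moment M (Y t) h" if "t \<ge> t\<^sub>0" for t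
  proof -
    have [measurable]: "Y (t + l) \<in> borel_measurable M" "Y t \<in> borel_measurable M"
      using that assms by (auto intro!: Y_measurable)
    have "exp_moment M (\<lambda>\<omega>. Y (t + l) \<omega> - Y t \<omega>) h \<le> 1"
      by (rule exp_moment_le_1_antimono[OF _ h incr[OF that]]) measurable
    from mult_left_mono[OF this, of "exp_moment M (Y t) h"] show ?thesis
      using exp_moment_increment[of t "t + l" h] that assms by simp
  qed
  \<comment> \<open>Induction on the number of backward steps allowed; the summand 1 makes the case
    \<open>n = 0\<close> the whole range \<open>t < t\<^sub>0 + l\<close>.\<close>
  have "exp_moment M (Y t) h \<le> ?S" if "0 \<le> t" "t < t\<^sub>0 + (real n + 1) * l" for t n
    using that
  proof (induction n arbitrary: t)
    case 0
    then show ?case by (intro SUP_upper) auto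
  next
    case (Suc n)
    show ?case
    proof (cases "t < t\<^sub>0 + l")
      case True
      then show ?thesis using Suc.prems by (intro SUP_upper) auto
    next
      case False
      \<comment> \<open>Here \<open>t - l \<ge> t\<^sub>0\<close>, so the step from
        \<open>t - l\<close> to \<open>t\<close> is admissible.\<close>
      then have "exp_moment M (Y t) h \<le> exp_moment M (Y (t - l)) h"
        using step[of "t - l"] by simp
      also have "\<dots> \<le> ?S"
        using Suc.prems False assms by (intro Suc.IH) (auto simp: algebra_simps)
      finally show ?thesis .
    qed
  qed
  moreover have "\<exists>n. t < t\<^sub>0 + (real n + 1) * l" for t
  proof -
    obtain n where "t < real n * l" using ex_less_of_nat_mult[OF \<open>l > 0\<close>] by blast
    then show ?thesis using assms by (intro exI[of _ n]) (simp add: algebra_simps)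
  qed
  ultimately show "(SUP t\<in>{0..}. exp_moment M (Y t) h) \<le> ?S"
    by (intro SUP_least) (metis atLeast_iff)
  show "?S \<le> (SUP t\<in>{0..}. exp_moment M (Y t) h)"
    by (rule SUP_subset_mono) auto
qed

end

theorem corollary3p1:
  fixes M :: "'a measure"
    and N :: "real \<Rightarrow> 'a \<Rightarrow> nat" and \<Lambda> \<Lambda>' :: "real \<Rightarrow> real"
    and Z :: "real \<Rightarrow> 'a \<Rightarrow> real"
    and p p' :: "real \<Rightarrow> real" and q :: "real \<Rightarrow> 'a \<Rightarrow> real"
    and r :: "real \<Rightarrow> real"
    and \<alpha> \<beta> :: "real \<Rightarrow> real \<Rightarrow> real \<Rightarrow> 'a \<Rightarrow> real"
    and R :: "real \<Rightarrow> real \<Rightarrow> 'a \<Rightarrow> real"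
    and Y :: "real \<Rightarrow> 'a \<Rightarrow> real"
    and l t\<^sub>0 L :: real
  assumes model: "standing_risk_model M N \<Lambda> Z p q r \<alpha> \<beta> R Y \<Lambda>' p'"
    and pos: "l > 0" "t\<^sub>0 > 0" "L > 0"
    and increments: "\<forall>t\<ge>t\<^sub>0. exp_moment M (\<lambda>\<omega>. Y (t + l) \<omega> - Y t \<omega>) L \<le> 1"
  shows
    "(\<forall>h\<in>{0..L}.
        (SUP t\<in>{0..}. exp_moment M (Y t) h) = (SUP t\<in>{0..<t\<^sub>0 + l}. exp_moment M (Y t) h) \<and>
        (\<forall>u>0. \<forall>T\<ge>0.
           ruin_prob_within M (R u) T \<le> prob_sup_greater M Y {0..T} u \<and>
           ennreal (prob_sup_greater M Y {0..T} u)
             \<le> ennreal (exp (- h * u)) * (SUP t\<in>{0..T}. exp_moment M (Y t) h)) \<and>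
        (\<forall>u>0.
           ruin_prob M (R u) \<le> prob_sup_greater M Y {0..} u \<and>
           ennreal (prob_sup_greater M Y {0..} u)
             \<le> ennreal (exp (- h * u)) * (SUP t\<in>{0..<t\<^sub>0 + l}. exp_moment M (Y t) h))) \<and>
     (\<forall>u>0.
        ennreal (ruin_prob M (R u))
          \<le> (INF h\<in>{0..L}. ennreal (exp (- h * u)) * (SUP t\<in>{0..<t\<^sub>0 + l}. exp_moment M (Y t) h)) \<and>
        (INF h\<in>{0..L}. ennreal (exp (- h * u)) * (SUP t\<in>{0..<t\<^sub>0 + l}. exp_moment M (Y t) h))
          \<le> (SUP t\<in>{0..<t\<^sub>0 + l}. exp_moment M (Y t) L) * ennreal (exp (- L * u)))"
proof -
  interpret standing_risk_model M N \<Lambda> Z p q r \<alpha> \<beta> R Y \<Lambda>' p'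
    by (rule model)
  let ?S = "\<lambda>h. SUP t\<in>{0..<t\<^sub>0 + l}. exp_moment M (Y t) h"
  have SUP_eq: "(SUP t\<in>{0..}. exp_moment M (Y t) h) = ?S h" if "h \<in> {0..L}" for h
    using that pos increments by (intro SUP_exp_moment_eq[where L = L]) auto
  \<comment> \<open>Both time sets are put into the form used for separability. The left end -1
    keeps 0 inside the open interval, and \<open>T\<close> is added as a single time; the half-line
    needs no added time.\<close>
  have split_T: "{0..T} = ({-1<..<T} \<inter> {0..}) \<union> {T}" if "T \<ge> 0" for T :: real
    using that by auto
  have split: "{0..} = (UNIV \<inter> {0..}) \<union> ({} :: real set)" by simp
  have ruin: "ruin_prob M (R u) \<le> prob_sup_greater M Y {0..} u" if "u > 0" for u
    unfolding ruin_prob_def using that by (intro ruin_le_exceedance[OF _ _ split]) auto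
  have exceed: "ennreal (prob_sup_greater M Y {0..} u) \<le> ennreal (exp (- h * u)) * ?S h"
    if "h \<in> {0..L}" for h u
    using exceedance_bound[OF _ _ split, of h u] that by (simp add: SUP_eq)
  have ruin_T: "ruin_prob_within M (R u) T \<le> prob_sup_greater M Y {0..T} u"
    if "u > 0" "T \<ge> 0" for u T
    unfolding ruin_prob_within_def
    using that by (intro ruin_le_exceedance[OF _ _ split_T]) (auto simp: is_interval_oo)
  have exceed_T: "ennreal (prob_sup_greater M Y {0..T} u)
      \<le> ennreal (exp (- h * u)) * (SUP t\<in>{0..T}. exp_moment M (Y t) h)"
    if "h \<in> {0..L}" "T \<ge> 0" for h u T
    using that by (intro exceedance_bound[OF _ _ split_T]) (auto simp: is_interval_oo)
  have "ennreal (ruin_prob M (R u)) \<le> (INF h\<in>{0..L}. ennreal (exp (- h * u)) * ?S h)"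
    if "u > 0" for u
    using ennreal_leI[OF ruin[OF that]] exceed by (blast intro: INF_greatest order_trans)
  \<comment> \<open>The infimum is bounded by its value at \<open>h = L\<close>, which gives the
    constant of the exponential bound.\<close>
  moreover have "(INF h\<in>{0..L}. ennreal (exp (- h * u)) * ?S h)
      \<le> ?S L * ennreal (exp (- L * u))" for u
    using pos by (intro INF_lower2[of L]) (auto simp: mult.commute)
  ultimately show ?thesis
    using SUP_eq ruin exceed ruin_T exceed_T by blast
qed

end
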